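(* Let $p,p'\in\mathbf{D}$ and let $g$ be a measurable real-valued function on $(\Omega,\mathcal{B})$ with bounded total variation $V(g)<\infty$. Then $$\left|\int_\Omega g(x)\,dp(x)-\int_\Omega g(x)\,dp'(x)\right|\le a\,V(g)\cdot\|p-p'\|_\infty,$$ where $a=2$. If $g$ is continuous, the inequality holds with $a=1$.
   Context: $\Omega=[0,1]$ and $\mathcal{B}$ is its Borel $\sigma$-algebra. $\mathbf{D}$ is the set of (right-continuous) distribution functions of probability measures on $(\Omega,\mathcal{B})$, viewed as functions on $\mathbb{R}$ vanishing for $x<0$ and equal to $1$ for $x\ge1$. $\int_\Omega g\,dp$ is the integral of $g$ against the probability measure on $\Omega$ with distribution function $p$ (including a possible atom at $0$). $\|\cdot\|_\infty$ is the supremum norm, and $V(g):=\sup\sum_{i=2}^n|g(x_i)-g(x_{i-1})|$, the supremum being over all $n\in\mathbb{N}$ and $x_1<x_2<\dots<x_n$ in $\Omega$. *)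

theory Defs
  imports "HOL-Probability.Probability"
begin

abbreviation Omega :: "real set" where
  "Omega \<equiv> {0..1}"

abbreviation borel_Omega :: "real measure" where
  "borel_Omega \<equiv> restrict_space borel Omega"

definition prob_measures :: "real measure set" where
  "prob_measures = {M. sets M = sets borel_Omega \<and> prob_space M}"

text \<open>The library constant \<^const>\<open>cdf\<close> cannot be applied to a measure living on
  \<open>Omega\<close>: the half-line \<open>{..x}\<close> is not a subset of that space, so it would get measure \<open>0\<close>.
  With the intersection, the function vanishes for \<open>x < 0\<close> and equals \<open>1\<close> for \<open>x \<ge> 1\<close>.\<close>

definition distr_fun :: "real measure \<Rightarrow> real \<Rightarrow> real" where
  "distr_fun M x = measure M (Omega \<inter> {..x})"

definition DD :: "(real \<Rightarrow> real) set" where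
  "DD = distr_fun ` prob_measures"

definition measure_of_df :: "(real \<Rightarrow> real) \<Rightarrow> real measure" where
  "measure_of_df p = (THE M. M \<in> prob_measures \<and> distr_fun M = p)"

definition stieltjes :: "(real \<Rightarrow> real) \<Rightarrow> (real \<Rightarrow> real) \<Rightarrow> real" where
  "stieltjes g p = integral\<^sup>L (measure_of_df p) g"

text \<open>A real-valued supremum, meaningful for bounded functions only; differences of
  elements of \<open>DD\<close> are bounded by \<open>1\<close>.\<close>

definition sup_norm :: "(real \<Rightarrow> real) \<Rightarrow> real" where
  "sup_norm f = (SUP x. \<bar>f x\<bar>)"

definition total_variation :: "(real \<Rightarrow> real) \<Rightarrow> ereal" where
  "total_variation g =
     Sup {ereal (\<Sum>i=2..n. \<bar>g (x i) - g (x (i - 1))\<bar>) | n x.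
            x ` {1..n} \<subseteq> Omega \<and> strict_mono_on {1..n::nat} x}"

text \<open>The definite description in \<open>measure_of_df\<close> is well defined: a probability measure
  on \<open>Omega\<close> is determined by its distribution function.\<close>

lemma distr_fun_inj:
  assumes M: "M \<in> prob_measures" and N: "N \<in> prob_measures"
    and eq: "distr_fun M = distr_fun N"
  shows "M = N"
proof -
  have ext: "real_distribution (distr K borel (\<lambda>x. x)) \<and> cdf (distr K borel (\<lambda>x. x)) = distr_fun K
      \<and> (\<forall>A\<in>sets borel_Omega. emeasure K A = emeasure (distr K borel (\<lambda>x. x)) A)"
    if K: "K \<in> prob_measures" for K
  proof -
    have s: "sets K = sets borel_Omega" and "prob_space K"
      using K by (auto simp: prob_measures_def)
    interpret prob_space K by fact
    have sp: "space K = Omega"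
      using sets_eq_imp_space_eq[OF s] by (simp add: space_restrict_space)
    have m: "(\<lambda>x. x) \<in> measurable K borel"
      unfolding measurable_cong_sets[OF s refl] by (intro measurable_restrict_space1) simp
    have "real_distribution (distr K borel (\<lambda>x. x))"
      using m by (rule real_distribution_distr)
    moreover have "cdf (distr K borel (\<lambda>x. x)) = distr_fun K"
      by (auto simp: cdf_def distr_fun_def measure_distr[OF m] sp Int_commute intro!: ext)
    moreover have "emeasure K A = emeasure (distr K borel (\<lambda>x. x)) A"
      if A: "A \<in> sets borel_Omega" for A
    proof -
      have "A \<in> sets borel" and "A \<subseteq> Omega"
        using A by (auto simp: sets_restrict_space)
      then show ?thesis
        by (simp add: emeasure_distr[OF m] sp Int_absorb2)
    qed
    ultimately show ?thesis by blast
  qed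
  have "distr M borel (\<lambda>x. x) = distr N borel (\<lambda>x. x)"
    using ext[OF M] ext[OF N] eq by (intro cdf_unique) auto
  then show ?thesis
    using ext[OF M] ext[OF N] M N by (intro measure_eqI) (auto simp: prob_measures_def)
qed

lemma measure_of_df_distr_fun:
  assumes "M \<in> prob_measures"
  shows "measure_of_df (distr_fun M) = M"
  unfolding measure_of_df_def using assms by (intro the_equality) (auto intro: distr_fun_inj)

end

(* A function of bounded variation is a difference of two nondecreasing functions whose
   oscillations add up to at most V(g).  A nondecreasing h is, up to a uniform error, a constant
   minus an equidistant layer-cake sum of indicators of the sublevel sets {h < t}.  These are
   initial segments [0,s] or [0,s), whose measures under the two distributions differ by at most
   the sup norm (use left limits for [0,s)).  Continuity of g plays no role: a = 1 always works. *)
theory Submission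
  imports Defs
begin

section \<open>Measures of initial segments\<close>

lemma prob_measuresD:
  assumes "M \<in> prob_measures"
  shows "prob_space M" "sets M = sets borel_Omega" "space M = Omega"
proof -
  show "prob_space M" and s: "sets M = sets borel_Omega"
    using assms by (auto simp: prob_measures_def)
  show "space M = Omega"
    using sets_eq_imp_space_eq[OF s] by (simp add: space_restrict_space)
qed

lemma prob_measures_sets:
  assumes "M \<in> prob_measures" "A \<in> sets borel"
  shows "Omega \<inter> A \<in> sets M"
  using assms by (auto simp: prob_measuresD sets_restrict_space)

text \<open>Both distribution functions take values between 0 and 1, so their difference has bounded
  range and the real supremum is a genuine upper bound.\<close>

lemma abs_le_sup_norm_diff:
  assumes "M \<in> prob_measures" "N \<in> prob_measures"
  shows "\<bar>distr_fun M x - distr_fun N x\<bar> \<le> sup_norm (\<lambda>x. distr_fun M x - distr_fun N x)"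
  unfolding sup_norm_def
proof (rule cSUP_upper)
  interpret M: prob_space M using assms by (simp add: prob_measuresD)
  interpret N: prob_space N using assms by (simp add: prob_measuresD)
  have "\<bar>distr_fun M x - distr_fun N x\<bar> \<le> 1" for x
    using M.prob_le_1[of "Omega \<inter> {..x}"] N.prob_le_1[of "Omega \<inter> {..x}"]
      measure_nonneg[of M "Omega \<inter> {..x}"] measure_nonneg[of N "Omega \<inter> {..x}"]
    unfolding distr_fun_def by linarith
  then show "bdd_above (range (\<lambda>x. \<bar>distr_fun M x - distr_fun N x\<bar>))"
    by (rule bdd_aboveI2)
qed simp

text \<open>The segment open at \<open>s\<close> is the increasing union of the closed segments
  \<open>A i\<close>, whose measures are values of the distribution functions. Continuity from below
  carries the bound to the limit, so an atom at \<open>s\<close> does no harm.\<close>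

lemma measure_lessThan_diff_le:
  assumes M: "M \<in> prob_measures" and N: "N \<in> prob_measures"
  shows "\<bar>measure M (Omega \<inter> {..<s}) - measure N (Omega \<inter> {..<s})\<bar>
           \<le> sup_norm (\<lambda>x. distr_fun M x - distr_fun N x)"
proof -
  define A where "A i = Omega \<inter> {..s - inverse (real (Suc i))}" for i
  have "(\<Union>i. A i) = Omega \<inter> {..<s}"
  proof (intro equalityI subsetI)
    fix x assume "x \<in> (\<Union>i. A i)"
    then obtain i where "x \<in> Omega" "x \<le> s - inverse (real (Suc i))"
      by (auto simp: A_def)
    moreover have "inverse (real (Suc i)) > 0" by simp
    ultimately show "x \<in> Omega \<inter> {..<s}" unfolding Int_iff lessThan_iff by linarith
  next
    fix x assume x: "x \<in> Omega \<inter> {..<s}"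
    then obtain i where "inverse (real (Suc i)) < s - x"
      using reals_Archimedean[of "s - x"] by auto
    then show "x \<in> (\<Union>i. A i)" using x by (auto simp: A_def intro!: exI[of _ i])
  qed
  moreover have "incseq A"
    unfolding A_def
  proof (rule incseq_SucI)
    fix i
    have "inverse (real (Suc (Suc i))) \<le> inverse (real (Suc i))" by (intro le_imp_inverse_le) auto
    then show "Omega \<inter> {..s - inverse (real (Suc i))} \<subseteq> Omega \<inter> {..s - inverse (real (Suc (Suc i)))}"
      by (intro Int_mono order_refl) (simp del: of_nat_Suc)
  qed
  ultimately have lim: "(\<lambda>i. measure K (A i)) \<longlonglongrightarrow> measure K (Omega \<inter> {..<s})"
    if "K \<in> prob_measures" for K
  proof -
    interpret prob_space K using that by (simp add: prob_measuresD)
    have "A i \<in> sets K" for i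
      unfolding A_def by (rule prob_measures_sets[OF that]) simp
    then have "range A \<subseteq> sets K" by blast
    from finite_Lim_measure_incseq[OF this \<open>incseq A\<close>] show ?thesis
      unfolding \<open>(\<Union>i. A i) = Omega \<inter> {..<s}\<close> .
  qed
  have "(\<lambda>i. \<bar>measure M (A i) - measure N (A i)\<bar>)
      \<longlonglongrightarrow> \<bar>measure M (Omega \<inter> {..<s}) - measure N (Omega \<inter> {..<s})\<bar>"
    by (intro tendsto_intros lim M N)
  then show ?thesis
    using abs_le_sup_norm_diff[OF M N] by (intro LIMSEQ_le_const2) (auto simp: A_def distr_fun_def)
qed

section \<open>Sublevel sets of nondecreasing functions are initial segments\<close>

text \<open>The endpoint is \<open>Sup A\<close>, and the two forms correspond to whether the
  supremum is attained.\<close>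

lemma downset_cases:
  fixes A :: "real set"
  assumes "A \<subseteq> Omega" and down: "\<And>x y. x \<in> A \<Longrightarrow> 0 \<le> y \<Longrightarrow> y \<le> x \<Longrightarrow> y \<in> A"
  obtains s where "A = Omega \<inter> {..s}" | s where "A = Omega \<inter> {..<s}"
proof (cases "A = {}")
  case True
  \<comment> \<open>The endpoint -1 lies to the left of \<open>Omega\<close>, so the segment is
    empty.\<close>
  then show ?thesis by (intro that(1)[of "-1"]) auto
next
  case False
  have bdd: "bdd_above A" by (rule bdd_above_mono[OF _ assms(1)]) simp
  have le: "x \<le> Sup A" if "x \<in> A" for x using that bdd by (rule cSup_upper)
  have lt: "x \<in> A" if "x < Sup A" "0 \<le> x" for x
    using that less_cSup_iff[OF False bdd, of x] down by (auto intro: less_imp_le)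
  show ?thesis
  proof (cases "Sup A \<in> A")
    case True
    then have "A = Omega \<inter> {..Sup A}" using le down assms(1) by auto
    then show ?thesis by (rule that(1))
  next
    case False
    then have "A = Omega \<inter> {..<Sup A}" using le lt assms(1) by (force simp: less_le)
    then show ?thesis by (rule that(2))
  qed
qed

lemma sublevel_cases:
  fixes h :: "real \<Rightarrow> real"
  assumes "mono_on Omega h"
  obtains s where "{x \<in> Omega. h x < t} = Omega \<inter> {..s}"
    | s where "{x \<in> Omega. h x < t} = Omega \<inter> {..<s}"
proof (rule downset_cases[of "{x \<in> Omega. h x < t}"])
  fix x y assume "x \<in> {x \<in> Omega. h x < t}" "0 \<le> y" "y \<le> x"
  moreover from this have "h y \<le> h x" by (intro mono_onD[OF assms]) auto
  ultimately show "y \<in> {x \<in> Omega. h x < t}" by auto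
qed (auto intro: that)

lemma sublevel_sets:
  fixes h :: "real \<Rightarrow> real"
  assumes "M \<in> prob_measures" "mono_on Omega h"
  shows "{x \<in> Omega. h x < t} \<in> sets M"
proof (rule sublevel_cases[OF assms(2), of t])
  show ?thesis if "{x \<in> Omega. h x < t} = Omega \<inter> {..s}" for s
    unfolding that by (rule prob_measures_sets[OF assms(1)]) simp
  show ?thesis if "{x \<in> Omega. h x < t} = Omega \<inter> {..<s}" for s
    unfolding that by (rule prob_measures_sets[OF assms(1)]) simp
qed

lemma measure_sublevel_diff_le:
  fixes h :: "real \<Rightarrow> real"
  assumes "M \<in> prob_measures" "N \<in> prob_measures" "mono_on Omega h"
  shows "\<bar>measure M {x \<in> Omega. h x < t} - measure N {x \<in> Omega. h x < t}\<bar>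
           \<le> sup_norm (\<lambda>x. distr_fun M x - distr_fun N x)"
proof (rule sublevel_cases[OF assms(3), of t])
  show ?thesis if "{x \<in> Omega. h x < t} = Omega \<inter> {..s}" for s
    using abs_le_sup_norm_diff[OF assms(1,2), of s] unfolding that distr_fun_def .
  show ?thesis if "{x \<in> Omega. h x < t} = Omega \<inter> {..<s}" for s
    unfolding that by (rule measure_lessThan_diff_le[OF assms(1,2)])
qed

section \<open>Nondecreasing integrands\<close>

text \<open>Sublevel sets are measurable because they are initial segments, and monotonicity bounds
  \<open>h\<close> on \<open>Omega\<close> by its values at 0 and 1.\<close>

lemma integrable_mono_on:
  fixes h :: "real \<Rightarrow> real"
  assumes M: "M \<in> prob_measures" and h: "mono_on Omega h"
  shows "integrable M h"
proof -
  interpret prob_space M using M by (simp add: prob_measuresD)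
  have "h \<in> borel_measurable M"
    unfolding borel_measurable_iff_less prob_measuresD(3)[OF M]
    using sublevel_sets[OF M h] by simp
  moreover have "\<bar>h x\<bar> \<le> \<bar>h 0\<bar> + \<bar>h 1\<bar>" if "x \<in> Omega" for x
    using mono_onD[OF h, of 0 x] mono_onD[OF h, of x 1] that by auto
  ultimately show ?thesis
    by (intro integrable_const_bound[of _ "\<bar>h 0\<bar> + \<bar>h 1\<bar>"]) (auto simp: prob_measuresD[OF M])
qed

section \<open>Layer approximation of nondecreasing functions\<close>

lemma card_levels:
  fixes u :: real
  assumes "0 \<le> u" "u \<le> real n"
  shows "real (card {k \<in> {1..n}. u < real k}) = real n - of_int \<lfloor>u\<rfloor>"
proof -
  have "{k \<in> {1..n}. u < real k} = {nat \<lfloor>u\<rfloor> + 1..n}"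
    using assms by (auto, linarith+)
  moreover have "nat \<lfloor>u\<rfloor> \<le> n" using assms by linarith
  ultimately show ?thesis using assms by (simp add: of_nat_diff)
qed

text \<open>The approximant is \<open>h\<close> rounded down to the grid of mesh
  \<open>\<delta>\<close> starting at \<open>h 0\<close>: at rescaled height \<open>u\<close>
  exactly \<open>n\<close> minus the floor of \<open>u\<close> levels lie above, so the error is the
  fractional part of \<open>u\<close> times \<open>\<delta>\<close>.\<close>

lemma mono_on_layers:
  fixes h :: "real \<Rightarrow> real"
  assumes h: "mono_on Omega h" and "h 0 < h 1" and "n > 0" and x: "x \<in> Omega"
  defines "\<delta> \<equiv> (h 1 - h 0) / n"
  shows "\<bar>h x - (h 1 - \<delta> * (\<Sum>k=1..n. indicator {y \<in> Omega. h y < h 0 + real k * \<delta>} x))\<bar> \<le> \<delta>"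
proof -
  have \<delta>: "\<delta> > 0" and n\<delta>: "real n * \<delta> = h 1 - h 0" using assms by (auto simp: \<delta>_def)
  define u where "u = (h x - h 0) / \<delta>"
  have hx: "h x = h 0 + u * \<delta>" using \<delta> by (simp add: u_def)
  have "h 0 \<le> h x" "h x \<le> h 1" using mono_onD[OF h] x by auto
  then have u: "0 \<le> u" "u \<le> real n" using \<delta> n\<delta> by (auto simp: u_def field_simps)
  define S :: real where "S = (\<Sum>k=1..n. indicator {y \<in> Omega. h y < h 0 + real k * \<delta>} x)"
  \<comment> \<open>Dividing by \<open>\<delta> > 0\<close> turns
    \<open>h x < h 0 + real k * \<delta>\<close> into \<open>u < real k\<close>.\<close>
  have "S = (\<Sum>k=1..n. if u < real k then 1 else 0 :: real)"
    unfolding S_def using x \<delta> by (intro sum.cong) (auto simp: hx indicator_def)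
  also have "\<dots> = real (card {k \<in> {1..n}. u < real k})"
    by (simp add: sum.If_cases Int_def)
  also have "\<dots> = real n - of_int \<lfloor>u\<rfloor>" using u by (rule card_levels)
  finally have S: "S = real n - of_int \<lfloor>u\<rfloor>" .
  have "\<delta> * S = real n * \<delta> - of_int \<lfloor>u\<rfloor> * \<delta>"
    unfolding S by (simp add: algebra_simps)
  then have "h x - (h 1 - \<delta> * S) = (u - of_int \<lfloor>u\<rfloor>) * \<delta>"
    unfolding left_diff_distrib using hx n\<delta> by linarith
  moreover have "0 \<le> u - of_int \<lfloor>u\<rfloor>" "u - of_int \<lfloor>u\<rfloor> \<le> 1" by linarith+
  ultimately show ?thesis using \<delta> unfolding S_def by (simp add: abs_mult mult_left_le_one_le)
qed

text \<open>Each of the \<open>n\<close> layers has weight \<open>\<delta>\<close> and contributes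
  at most \<open>\<delta>\<close> times the sup norm, and these weights add up to
  \<open>h 1 - h 0\<close>. Replacing \<open>h\<close> by its layer sum costs
  \<open>\<delta>\<close> under each of the two measures, hence the remainder
  \<open>2 * \<delta>\<close>.\<close>

lemma integral_diff_mono_on_layers:
  fixes h :: "real \<Rightarrow> real" and n :: nat
  assumes M: "M \<in> prob_measures" and N: "N \<in> prob_measures" and h: "mono_on Omega h"
    and "h 0 < h 1" and n: "n > 0"
  shows "\<bar>integral\<^sup>L M h - integral\<^sup>L N h\<bar>
           \<le> (h 1 - h 0) * sup_norm (\<lambda>x. distr_fun M x - distr_fun N x) + 2 * (h 1 - h 0) / n"
proof -
  define \<delta> where "\<delta> = (h 1 - h 0) / n"
  have \<delta>: "\<delta> > 0" and n\<delta>: "real n * \<delta> = h 1 - h 0" using assms by (auto simp: \<delta>_def)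
  define A where "A k = {x \<in> Omega. h x < h 0 + real k * \<delta>}" for k
  define s where "s = sup_norm (\<lambda>x. distr_fun M x - distr_fun N x)"
  have approx: "\<bar>integral\<^sup>L K h - (h 1 - \<delta> * (\<Sum>k=1..n. measure K (A k)))\<bar> \<le> \<delta>"
    if K: "K \<in> prob_measures" for K
  proof -
    interpret prob_space K using K by (simp add: prob_measuresD)
    have [simp]: "A k \<in> sets K" for k unfolding A_def by (rule sublevel_sets[OF K h])
    let ?f = "\<lambda>x. h 1 - \<delta> * (\<Sum>k=1..n. indicator (A k) x)"
    have f: "integrable K ?f" by (auto simp: less_top[symmetric])
    have I: "integral\<^sup>L K ?f = h 1 - \<delta> * (\<Sum>k=1..n. measure K (A k))"
      by (simp add: less_top[symmetric] prob_space)
    have "\<bar>integral\<^sup>L K h - integral\<^sup>L K ?f\<bar> = \<bar>integral\<^sup>L K (\<lambda>x. h x - ?f x)\<bar>"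
      by (simp only: Bochner_Integration.integral_diff[OF integrable_mono_on[OF K h] f])
    also have "\<dots> \<le> integral\<^sup>L K (\<lambda>x. \<bar>h x - ?f x\<bar>)"
      by (rule integral_abs_bound)
    also have "\<dots> \<le> integral\<^sup>L K (\<lambda>x. \<delta>)"
    proof (rule integral_mono)
      show "integrable K (\<lambda>x. \<bar>h x - ?f x\<bar>)"
        by (intro integrable_abs Bochner_Integration.integrable_diff[OF integrable_mono_on[OF K h] f])
      show "\<bar>h x - ?f x\<bar> \<le> \<delta>" if "x \<in> space K" for x
        using mono_on_layers[OF h \<open>h 0 < h 1\<close> n, of x] that
        unfolding prob_measuresD(3)[OF K] A_def \<delta>_def by simp
    qed simp
    also have "\<dots> = \<delta>" by (simp add: prob_space)
    finally show ?thesis unfolding I .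
  qed
  have "\<bar>(\<Sum>k=1..n. measure M (A k)) - (\<Sum>k=1..n. measure N (A k))\<bar>
      \<le> (\<Sum>k=1..n. \<bar>measure M (A k) - measure N (A k)\<bar>)"
    unfolding sum_subtractf[symmetric] by (rule sum_abs)
  also have "\<dots> \<le> (\<Sum>k=1..n. s)"
    unfolding A_def s_def by (intro sum_mono measure_sublevel_diff_le M N h)
  finally have "\<bar>(\<Sum>k=1..n. measure M (A k)) - (\<Sum>k=1..n. measure N (A k))\<bar> \<le> real n * s" by simp
  then have "\<bar>\<delta> * (\<Sum>k=1..n. measure M (A k)) - \<delta> * (\<Sum>k=1..n. measure N (A k))\<bar> \<le> \<delta> * (real n * s)"
    using \<delta> by (simp add: right_diff_distrib[symmetric] abs_mult)
  also have "\<dots> = (h 1 - h 0) * s" unfolding n\<delta>[symmetric] by simp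
  finally have "\<bar>integral\<^sup>L M h - integral\<^sup>L N h\<bar> \<le> (h 1 - h 0) * s + 2 * \<delta>"
    using approx[OF M] approx[OF N] by linarith
  then show ?thesis by (simp add: s_def \<delta>_def)
qed

text \<open>The remainder of the layer estimate vanishes as \<open>n\<close> grows. If
  \<open>h 0 < h 1\<close> fails, the mesh degenerates, but then \<open>h\<close> is constant on
  \<open>Omega\<close> and both integrals equal \<open>h 0\<close>.\<close>

lemma integral_diff_mono_on:
  fixes h :: "real \<Rightarrow> real"
  assumes M: "M \<in> prob_measures" and N: "N \<in> prob_measures" and h: "mono_on Omega h"
  shows "\<bar>integral\<^sup>L M h - integral\<^sup>L N h\<bar>
           \<le> (h 1 - h 0) * sup_norm (\<lambda>x. distr_fun M x - distr_fun N x)"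
proof (cases "h 0 < h 1")
  case True
  let ?c = "(h 1 - h 0) * sup_norm (\<lambda>x. distr_fun M x - distr_fun N x)"
  have "(\<lambda>n. ?c + 2 * (h 1 - h 0) / real n) \<longlonglongrightarrow> ?c + 0"
    by (intro tendsto_add tendsto_const lim_const_over_n)
  then show ?thesis
    using integral_diff_mono_on_layers[OF M N h True]
    by (intro LIMSEQ_le_const[of _ ?c]) (auto intro!: exI[of _ 1])
next
  case False
  have const: "h x = h 0" "h 1 = h 0" if "x \<in> Omega" for x
    using mono_onD[OF h, of 0 x] mono_onD[OF h, of x 1] False that by auto
  have "integral\<^sup>L K h = h 0" if K: "K \<in> prob_measures" for K
  proof -
    interpret prob_space K using K by (simp add: prob_measuresD)
    have "integral\<^sup>L K h = integral\<^sup>L K (\<lambda>x. h 0)"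
      using const(1) prob_measuresD(3)[OF K]
      by (intro Bochner_Integration.integral_cong[OF refl]) blast
    then show ?thesis by (simp add: prob_space)
  qed
  then show ?thesis using M N const(2)[of 0] by simp
qed

section \<open>Jordan decomposition\<close>

text \<open>Points are indexed from 1, so chains with at most one point have variation 0.\<close>

definition chain_variation :: "(real \<Rightarrow> real) \<Rightarrow> nat \<Rightarrow> (nat \<Rightarrow> real) \<Rightarrow> real" where
  "chain_variation g n c = (\<Sum>i=2..n. \<bar>g (c i) - g (c (i - 1))\<bar>)"

definition chain_in :: "real set \<Rightarrow> nat \<Rightarrow> (nat \<Rightarrow> real) \<Rightarrow> bool" where
  "chain_in S n c \<longleftrightarrow> c ` {1..n} \<subseteq> S \<and> strict_mono_on {1..n} c"

text \<open>The variation function of \<open>g\<close>. The supremum is taken in the reals and is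
  meaningful only where the sums are bounded, which finite total variation ensures for
  \<open>x \<le> 1\<close>.\<close>

definition variation_upto :: "(real \<Rightarrow> real) \<Rightarrow> real \<Rightarrow> real" where
  "variation_upto g x = Sup {chain_variation g n c | n c. chain_in {0..x} n c}"

lemma total_variation_eq:
  "total_variation g = Sup {ereal (chain_variation g n c) | n c. chain_in Omega n c}"
  unfolding total_variation_def chain_variation_def chain_in_def ..

lemma chain_in_mono: "chain_in S n c \<Longrightarrow> S \<subseteq> T \<Longrightarrow> chain_in T n c"
  by (auto simp: chain_in_def)

text \<open>By strict monotonicity \<open>c n\<close> is the largest point of the chain, so a new
  point to its right keeps the order, and the old increments do not see the update at
  \<open>Suc n\<close>.\<close>

lemma chain_append:
  assumes c: "chain_in S n c" and n: "n \<ge> 1" and y: "c n < y" "y \<in> S"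
  shows "chain_in S (Suc n) (c(Suc n := y))"
    and "chain_variation g (Suc n) (c(Suc n := y)) = chain_variation g n c + \<bar>g y - g (c n)\<bar>"
proof -
  have "c i \<le> c n" if "i \<in> {1..n}" for i
    using c that n by (auto simp: chain_in_def intro: strict_mono_on_leD)
  then have "c i < y" if "i \<in> {1..n}" for i using that y(1) by force
  moreover have "c i < c j" if "i \<in> {1..n}" "j \<in> {1..n}" "i < j" for i j
    using c that strict_mono_onD[of "{1..n}" c i j] by (simp add: chain_in_def)
  ultimately have "strict_mono_on {1..Suc n} (c(Suc n := y))"
    by (intro strict_mono_onI) (auto simp: le_Suc_eq)
  moreover have "c i \<in> S" if "i \<in> {1..n}" for i
    using c that by (auto simp: chain_in_def)
  then have "(c(Suc n := y)) ` {1..Suc n} \<subseteq> S"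
    using y(2) by (auto simp: le_Suc_eq)
  ultimately show "chain_in S (Suc n) (c(Suc n := y))"
    unfolding chain_in_def by blast
  have "(\<Sum>i=2..n. \<bar>g ((c(Suc n := y)) i) - g ((c(Suc n := y)) (i - 1))\<bar>)
      = (\<Sum>i=2..n. \<bar>g (c i) - g (c (i - 1))\<bar>)"
    by (intro sum.cong) auto
  then show "chain_variation g (Suc n) (c(Suc n := y)) = chain_variation g n c + \<bar>g y - g (c n)\<bar>"
    using n by (simp add: chain_variation_def)
qed

text \<open>Appending \<open>x\<close> adds a nonnegative increment. With last point
  \<open>x\<close>, the next point \<open>y\<close> will contribute exactly the increment from
  \<open>g x\<close> to \<open>g y\<close>.\<close>

lemma chain_ending_at:
  assumes c: "chain_in {0..x} n c" and "0 \<le> x"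
  obtains m d where "chain_in {0..x} m d" "m \<ge> 1" "d m = x"
    "chain_variation g n c \<le> chain_variation g m d"
proof (cases "n \<ge> 1")
  \<comment> \<open>The empty chain is replaced by the one-point chain at \<open>x\<close>; both
    have variation 0.\<close>
  case False
  then show ?thesis
    using assms by (intro that[of 1 "\<lambda>_. x"]) (auto simp: chain_in_def chain_variation_def strict_mono_on_def)
next
  case True
  then have "n \<in> {1..n}" by simp
  then have "c n \<in> {0..x}" using c unfolding chain_in_def by blast
  then consider "c n = x" | "c n < x" by fastforce
  then show ?thesis
  proof cases
    case 1
    then show ?thesis using that c True by blast
  next
    case 2
    then show ?thesis
      using chain_append[OF c True 2] \<open>0 \<le> x\<close> by (intro that[of "Suc n" "c(Suc n := x)"]) auto
  qed
qed

section \<open>The variation function under finite total variation\<close>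

context
  fixes g :: "real \<Rightarrow> real"
  assumes finite_variation: "total_variation g < \<infinity>"
begin

lemma chain_variation_le:
  assumes "chain_in Omega n c"
  shows "chain_variation g n c \<le> real_of_ereal (total_variation g)"
proof -
  have "ereal (chain_variation g n c) \<le> total_variation g"
    unfolding total_variation_eq using assms by (intro Sup_upper) auto
  \<comment> \<open>The real lower bound excludes the value \<open>-\<infinity>\<close>, so the
    conversion to a real is faithful.\<close>
  then show ?thesis using finite_variation by (cases "total_variation g") auto
qed

lemma chain_variation_le_variation_upto:
  assumes "chain_in {0..x} n c" "x \<le> 1"
  shows "chain_variation g n c \<le> variation_upto g x"
proof -
  have "{0..x} \<subseteq> Omega" using assms by auto
  then have "bdd_above {chain_variation g n c | n c. chain_in {0..x} n c}"
    using chain_variation_le chain_in_mono by (intro bdd_aboveI) blast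
  then show ?thesis unfolding variation_upto_def using assms by (intro cSup_upper) auto
qed

lemma variation_upto_leI:
  assumes "\<And>n c. chain_in {0..x} n c \<Longrightarrow> chain_variation g n c \<le> B"
  shows "variation_upto g x \<le> B"
proof -
  \<comment> \<open>The empty chain makes the set of sums nonempty, as \<open>cSup_least\<close>
    requires.\<close>
  have "chain_in {0..x} 0 (\<lambda>_. 0)" by (simp add: chain_in_def)
  then show ?thesis unfolding variation_upto_def using assms by (intro cSup_least) blast+
qed

lemma variation_upto_nonneg: "x \<le> 1 \<Longrightarrow> 0 \<le> variation_upto g x"
  using chain_variation_le_variation_upto[of x 0 "\<lambda>_. 0"]
  by (simp add: chain_in_def chain_variation_def)

text \<open>Every chain up to \<open>x\<close> may be assumed to end at \<open>x\<close>; appending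
  \<open>y\<close> then gives a chain up to \<open>y\<close> with the extra increment.\<close>

lemma variation_upto_step:
  assumes "0 \<le> x" "x < y" "y \<le> 1"
  shows "variation_upto g x + \<bar>g y - g x\<bar> \<le> variation_upto g y"
proof -
  have "variation_upto g x \<le> variation_upto g y - \<bar>g y - g x\<bar>"
  proof (rule variation_upto_leI)
    fix n c assume "chain_in {0..x} n c"
    then obtain m d where d: "chain_in {0..x} m d" "m \<ge> 1" "d m = x"
      "chain_variation g n c \<le> chain_variation g m d"
      using chain_ending_at assms(1) by blast
    have "chain_in {0..y} m d" using chain_in_mono[OF d(1)] assms by auto
    from chain_append[OF this d(2), of y]
    show "chain_variation g n c \<le> variation_upto g y - \<bar>g y - g x\<bar>"
      using chain_variation_le_variation_upto[of y "Suc m" "d(Suc m := y)"] d assms by simp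
  qed
  then show ?thesis by simp
qed

text \<open>The variation function grows at least as fast as \<open>g\<close> moves in either
  direction. The factor 1/2 makes the difference of the two functions \<open>g\<close> and their sum
  the variation function.\<close>

lemma mono_on_variation_upto:
  shows "mono_on Omega (\<lambda>x. (variation_upto g x + g x) / 2)"
    and "mono_on Omega (\<lambda>x. (variation_upto g x - g x) / 2)"
proof -
  have "variation_upto g x + \<bar>g y - g x\<bar> \<le> variation_upto g y" if "x \<in> Omega" "y \<in> Omega" "x \<le> y" for x y
    using variation_upto_step[of x y] that by (cases "x = y") auto
  then show "mono_on Omega (\<lambda>x. (variation_upto g x + g x) / 2)"
    and "mono_on Omega (\<lambda>x. (variation_upto g x - g x) / 2)"
    by (fastforce intro!: mono_onI simp: divide_right_mono)+
qed

lemma integral_diff_le_variation: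
  assumes M: "M \<in> prob_measures" and N: "N \<in> prob_measures"
  shows "\<bar>integral\<^sup>L M g - integral\<^sup>L N g\<bar>
           \<le> real_of_ereal (total_variation g) * sup_norm (\<lambda>x. distr_fun M x - distr_fun N x)"
proof -
  define P where "P x = (variation_upto g x + g x) / 2" for x
  define Q where "Q x = (variation_upto g x - g x) / 2" for x
  define s where "s = sup_norm (\<lambda>x. distr_fun M x - distr_fun N x)"
  have P: "mono_on Omega P" and Q: "mono_on Omega Q"
    unfolding P_def Q_def by (rule mono_on_variation_upto)+
  \<comment> \<open>A purely algebraic identity, valid also outside \<open>Omega\<close>, whatever
    value \<open>variation_upto\<close> has there.\<close>
  have "g = (\<lambda>x. P x - Q x)" by (auto simp: P_def Q_def field_simps)
  then have I: "integral\<^sup>L K g = integral\<^sup>L K P - integral\<^sup>L K Q" if "K \<in> prob_measures" for K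
    using integrable_mono_on[OF that P] integrable_mono_on[OF that Q] by simp
  have "\<bar>integral\<^sup>L M g - integral\<^sup>L N g\<bar>
      \<le> \<bar>integral\<^sup>L M P - integral\<^sup>L N P\<bar> + \<bar>integral\<^sup>L M Q - integral\<^sup>L N Q\<bar>"
    unfolding I[OF M] I[OF N] by linarith
  also have "\<dots> \<le> (P 1 - P 0) * s + (Q 1 - Q 0) * s"
    unfolding s_def by (intro add_mono integral_diff_mono_on M N P Q)
  \<comment> \<open>The values of \<open>g\<close> cancel, so the oscillations of \<open>P\<close>
    and \<open>Q\<close> add up to a single variation; this keeps the constant at 1.\<close>
  also have "\<dots> = (variation_upto g 1 - variation_upto g 0) * s"
    by (simp add: P_def Q_def field_simps)
  also have "\<dots> \<le> real_of_ereal (total_variation g) * s"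
  proof (rule mult_right_mono)
    show "0 \<le> s" using abs_le_sup_norm_diff[OF M N, of 0] by (simp add: s_def)
    have "variation_upto g 1 \<le> real_of_ereal (total_variation g)"
      using chain_variation_le by (intro variation_upto_leI) auto
    then show "variation_upto g 1 - variation_upto g 0 \<le> real_of_ereal (total_variation g)"
      using variation_upto_nonneg[of 0] by simp
  qed
  finally show ?thesis unfolding s_def .
qed

end

theorem theorem2:
  fixes p p' g :: "real \<Rightarrow> real"
  assumes "p \<in> DD" and "p' \<in> DD"
    and "g \<in> borel_measurable borel_Omega"
    and "total_variation g < \<infinity>"
  shows "ereal \<bar>stieltjes g p - stieltjes g p'\<bar>
           \<le> 2 * total_variation g * ereal (sup_norm (\<lambda>x. p x - p' x)) \<and>
         (continuous_on Omega g \<longrightarrow>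
           ereal \<bar>stieltjes g p - stieltjes g p'\<bar>
             \<le> total_variation g * ereal (sup_norm (\<lambda>x. p x - p' x)))"
proof -
  obtain M N where M: "M \<in> prob_measures" "p = distr_fun M" and N: "N \<in> prob_measures" "p' = distr_fun N"
    using assms(1,2) by (auto simp: DD_def)
  define s where "s = sup_norm (\<lambda>x. p x - p' x)"
  define v where "v = real_of_ereal (total_variation g)"
  \<comment> \<open>The empty chain shows that the total variation is at least 0; being also below
    \<open>\<infinity>\<close>, it is a nonnegative real \<open>v\<close>.\<close>
  have "chain_in Omega 0 (\<lambda>_. 0)" by (simp add: chain_in_def)
  then have "ereal (chain_variation g 0 (\<lambda>_. 0)) \<le> total_variation g"
    unfolding total_variation_eq by (intro Sup_upper) blast
  then have V: "total_variation g = ereal v" and "0 \<le> v"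
    using assms(4) by (cases "total_variation g"; simp add: chain_variation_def v_def)+
  moreover have "0 \<le> s" using abs_le_sup_norm_diff[OF M(1) N(1), of 0] by (simp add: s_def M N)
  moreover have "\<bar>stieltjes g p - stieltjes g p'\<bar> \<le> v * s"
    using integral_diff_le_variation[OF assms(4) M(1) N(1)]
    by (simp add: stieltjes_def M N measure_of_df_distr_fun v_def s_def)
  \<comment> \<open>Both conjuncts follow from the bound with constant 1, since \<open>v * s\<close>
    is nonnegative.\<close>
  ultimately have "\<bar>stieltjes g p - stieltjes g p'\<bar> \<le> v * s" "v * s \<le> 2 * v * s"
    by (simp_all add: mult_right_mono)
  then show ?thesis unfolding V s_def[symmetric] by (auto simp: numeral_eq_ereal)
qed

end
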